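(* Let $n\ge 1$, let $I_1,\ldots,I_n$ be independent random variables with values in $\{0,1\}$, $p_i=\Pr(I_i=1)=1-\Pr(I_i=0)\in[0,1]$, and let $S_n=I_1+\cdots+I_n$, with probability mass function $f_n(k)=\Pr(S_n=k)$, $k=0,1,\ldots$. Put $\lambda_j=\sum_{i=1}^n p_i^j$ for $j=1,2,\ldots$ and $\lambda=\lambda_1=\sum_{i=1}^n p_i$, and assume $\lambda>0$. Define $$\phi_3(k)=e^{-\lambda}\frac{\lambda^k}{k!}\Big(1-\frac{\lambda_2}{2\lambda^2}P_2(k)+\frac{\lambda_3}{3\lambda^3}P_3(k)+\frac{\lambda_2^2}{8\lambda^4}P_4(k)\Big),\qquad k=0,1,\ldots,$$ where $P_m(k)=\sum_{j=0}^m(-1)^{m-j}\binom mj\lambda^{m-j}(k)_j$ are the Poisson–Charlier polynomials. Then $$d_{\mathrm{tv}}(f_n,\phi_3)\le d_2(f_n,\phi_3)\le\frac23(\lambda^2+4\lambda+3)\,e^{2\lambda}\sum_{i=1}^n p_i^4.$$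
   Context: Here $(k)_m=k(k-1)\cdots(k-m+1)$ with $(k)_0=1$. Let $\mathcal F_2$ be the set of functions $g:\{0,1,\ldots\}\to\mathbb R$ such that $\sum_{k=0}^\infty |g(k)|u^k<\infty$ for some $u>2$ and $\sum_{k=0}^\infty g(k)=1$ ($g$ may take negative values). Both $f_n$ and $\phi_3$ belong to $\mathcal F_2$. For $g\in\mathcal F_2$ the $m$-th factorial moment is $\mu_m(g)=\sum_{k=m}^\infty (k)_m\,g(k)$, $m=0,1,\ldots$. For $g_1,g_2\in\mathcal F_2$ define $$d_{\mathrm{tv}}(g_1,g_2)=\frac12\sum_{k=0}^\infty|g_1(k)-g_2(k)|,\qquad d_2(g_1,g_2)=\frac12\sum_{m=1}^\infty\frac{2^m}{m!}\,|\mu_m(g_1)-\mu_m(g_2)|.$$ *)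

theory Defs
  imports "HOL-Probability.Probability"
begin

definition falling :: "nat \<Rightarrow> nat \<Rightarrow> real" where
  "falling k m = (\<Prod>i<m. real k - real i)"

definition F2 :: "(nat \<Rightarrow> real) set" where
  "F2 = {g. (\<exists>u>2. summable (\<lambda>k. \<bar>g k\<bar> * u ^ k)) \<and> g sums 1}"

definition factorial_moment :: "nat \<Rightarrow> (nat \<Rightarrow> real) \<Rightarrow> real" where
  "factorial_moment m g = (\<Sum>k. falling (k + m) m * g (k + m))"

text \<open>
  The two distances are extended-valued: for \<open>u\<close> close to 2 the exponential decay required
  by \<open>F2\<close> does not force the series in \<open>d2\<close> to converge, and a divergent series then has
  the value \<open>\<infinity>\<close>. The index \<open>m\<close> of the second series is shifted so as to start from 1.
\<close>

definition dtv :: "(nat \<Rightarrow> real) \<Rightarrow> (nat \<Rightarrow> real) \<Rightarrow> ennreal" where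
  "dtv g h = (\<Sum>k. ennreal \<bar>g k - h k\<bar>) / 2"

definition d2 :: "(nat \<Rightarrow> real) \<Rightarrow> (nat \<Rightarrow> real) \<Rightarrow> ennreal" where
  "d2 g h = (\<Sum>m. ennreal (2 ^ Suc m / fact (Suc m) *
     \<bar>factorial_moment (Suc m) g - factorial_moment (Suc m) h\<bar>)) / 2"

definition power_sum :: "(nat \<Rightarrow> real) \<Rightarrow> nat \<Rightarrow> nat \<Rightarrow> real" where
  "power_sum p n j = (\<Sum>i=1..n. p i ^ j)"

definition charlier :: "real \<Rightarrow> nat \<Rightarrow> nat \<Rightarrow> real" where
  "charlier l m k =
     (\<Sum>j\<le>m. (-1) ^ (m - j) * real (m choose j) * l ^ (m - j) * falling k j)"

definition phi3 :: "(nat \<Rightarrow> real) \<Rightarrow> nat \<Rightarrow> nat \<Rightarrow> real" where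
  "phi3 p n k =
     (let l = power_sum p n 1; l2 = power_sum p n 2; l3 = power_sum p n 3
      in exp (- l) * l ^ k / fact k *
         (1 - l2 / (2 * l ^ 2) * charlier l 2 k
            + l3 / (3 * l ^ 3) * charlier l 3 k
            + l2 ^ 2 / (8 * l ^ 4) * charlier l 4 k))"

definition sum_density :: "'a measure \<Rightarrow> (nat \<Rightarrow> 'a \<Rightarrow> nat) \<Rightarrow> nat \<Rightarrow> nat \<Rightarrow> real" where
  "sum_density M X n k = \<P>(\<omega> in M. (\<Sum>i=1..n. X i \<omega>) = k)"

text \<open>
  The remaining facts show that the real-valued series above converge where they are used:
  factorial moments exist on \<open>F2\<close>, and \<open>F2\<close> contains both functions to be compared.
\<close>

lemma falling_eq_0: "k < m \<Longrightarrow> falling k m = 0"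
  by (auto simp: falling_def)

lemma falling_eq_choose: "falling k m = fact m * real (k choose m)"
  by (simp add: falling_def binomial_gbinomial gbinomial_mult_fact atLeast0LessThan)

lemma falling_add: "falling (k + m) m = fact (k + m) / fact k"
  by (simp add: falling_eq_choose binomial_fact)

lemma summable_factorial_moment:
  assumes "g \<in> F2"
  shows "summable (\<lambda>k. falling (k + m) m * g (k + m))"
proof -
  obtain u where u: "u > 2" "summable (\<lambda>k. \<bar>g k\<bar> * u ^ k)"
    using assms by (auto simp: F2_def)
  have "summable (\<lambda>k. falling k m * g k)"
  proof (rule summable_comparison_test')
    show "summable (\<lambda>k. fact m * (\<bar>g k\<bar> * u ^ k))"
      using u(2) by (rule summable_mult)
  next
    fix k :: nat
    have "k choose m \<le> 2 ^ k"
      by (rule binomial_le_pow2)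
    then have "real (k choose m) \<le> 2 ^ k"
      by (metis of_nat_le_iff of_nat_numeral of_nat_power)
    also have "\<dots> \<le> u ^ k"
      using u(1) by (intro power_mono) auto
    finally have "\<bar>g k\<bar> * real (k choose m) \<le> \<bar>g k\<bar> * u ^ k"
      by (rule mult_left_mono) auto
    then show "norm (falling k m * g k) \<le> fact m * (\<bar>g k\<bar> * u ^ k)"
      by (simp add: falling_eq_choose abs_mult mult_ac)
  qed
  then show ?thesis
    by (subst summable_iff_shift)
qed

lemma poisson_falling_sums:
  "(\<lambda>k. exp (- l) * l ^ k / fact k * falling k j * u ^ k) sums ((l * u) ^ j * exp (l * (u - 1)))"
proof -
  have "(\<lambda>k. (l * u) ^ k / fact k) sums exp (l * u)"
    using exp_converges[of "l * u"] by (simp add: divide_inverse mult.commute)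
  then have "(\<lambda>k. exp (- l) * (l * u) ^ j * ((l * u) ^ k / fact k))
      sums (exp (- l) * (l * u) ^ j * exp (l * u))"
    by (rule sums_mult)
  moreover have "exp (- l) * (l * u) ^ j * exp (l * u) = (l * u) ^ j * exp (l * (u - 1))"
    by (simp add: mult.assoc mult.left_commute algebra_simps flip: exp_add)
  moreover have "(\<lambda>k. exp (- l) * (l * u) ^ j * ((l * u) ^ k / fact k))
      = (\<lambda>k. exp (- l) * l ^ (k + j) / fact (k + j) * falling (k + j) j * u ^ (k + j))"
    by (auto simp: falling_add power_add power_mult_distrib field_simps)
  ultimately have "(\<lambda>k. exp (- l) * l ^ (k + j) / fact (k + j) * falling (k + j) j * u ^ (k + j))
      sums ((l * u) ^ j * exp (l * (u - 1)))"
    by simp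
  then show ?thesis
    by (subst (asm) sums_iff_shift) (simp add: falling_eq_0)
qed

lemma poisson_charlier_sums:
  "(\<lambda>k. exp (- l) * l ^ k / fact k * charlier l m k * u ^ k)
     sums ((l * (u - 1)) ^ m * exp (l * (u - 1)))"
proof -
  have "(\<lambda>k. \<Sum>j\<le>m. (-1) ^ (m - j) * real (m choose j) * l ^ (m - j) *
          (exp (- l) * l ^ k / fact k * falling k j * u ^ k))
      sums (\<Sum>j\<le>m. (-1) ^ (m - j) * real (m choose j) * l ^ (m - j) *
          ((l * u) ^ j * exp (l * (u - 1))))"
    by (intro sums_sum sums_mult poisson_falling_sums)
  moreover have "(\<Sum>j\<le>m. (-1) ^ (m - j) * real (m choose j) * l ^ (m - j) *
          ((l * u) ^ j * exp (l * (u - 1)))) = (l * u + - l) ^ m * exp (l * (u - 1))"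
    unfolding binomial_ring sum_distrib_right
    by (intro sum.cong refl) (simp add: power_minus[of l] mult_ac)
  ultimately show ?thesis
    by (simp add: charlier_def sum_distrib_left sum_distrib_right mult_ac algebra_simps)
qed

lemma phi3_in_F2: "phi3 p n \<in> F2"
proof -
  define l where "l = power_sum p n 1"
  define c where "c = power_sum p n 2 / (2 * l ^ 2)"
  define d where "d = power_sum p n 3 / (3 * l ^ 3)"
  define e where "e = power_sum p n 2 ^ 2 / (8 * l ^ 4)"
  define w where "w k = exp (- l) * l ^ k / fact k" for k
  have phi: "phi3 p n k * u ^ k = w k * charlier l 0 k * u ^ k - c * (w k * charlier l 2 k * u ^ k)
      + d * (w k * charlier l 3 k * u ^ k) + e * (w k * charlier l 4 k * u ^ k)" for k u
  proof -
    have "phi3 p n k = w k * (1 - c * charlier l 2 k + d * charlier l 3 k + e * charlier l 4 k)"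
      unfolding phi3_def Let_def w_def c_def d_def e_def l_def by (rule refl)
    moreover have "charlier l 0 k = 1"
      by (simp add: charlier_def falling_def)
    ultimately show ?thesis
      by (simp only:) (simp add: algebra_simps)
  qed
  have sums: "(\<lambda>k. phi3 p n k * u ^ k) sums
     ((l * (u - 1)) ^ 0 * exp (l * (u - 1)) - c * ((l * (u - 1)) ^ 2 * exp (l * (u - 1)))
      + d * ((l * (u - 1)) ^ 3 * exp (l * (u - 1)) ) + e * ((l * (u - 1)) ^ 4 * exp (l * (u - 1))))"
    for u
    unfolding phi w_def by (intro sums_add sums_diff sums_mult poisson_charlier_sums)
  have "summable (\<lambda>k. norm (phi3 p n k * 3 ^ k))"
    by (rule powser_insidea[OF sums_summable[OF sums[of 4]]]) auto
  then have "summable (\<lambda>k. \<bar>phi3 p n k\<bar> * 3 ^ k)"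
    by (simp add: abs_mult)
  moreover have "phi3 p n sums 1"
    using sums[of 1] by simp
  ultimately show ?thesis
    unfolding F2_def by (auto intro!: exI[of _ "3::real"])
qed

lemma sum_density_in_F2:
  assumes "prob_space M"
    and "\<And>i. i \<in> {1..n} \<Longrightarrow> X i \<in> measurable M (count_space UNIV)"
    and "\<And>i \<omega>. i \<in> {1..n} \<Longrightarrow> \<omega> \<in> space M \<Longrightarrow> X i \<omega> \<in> {0, 1}"
  shows "sum_density M X n \<in> F2"
proof -
  interpret prob_space M by fact
  define S where "S \<omega> = (\<Sum>i=1..n. X i \<omega>)" for \<omega>
  have S_meas: "S \<in> measurable M (count_space UNIV)"
    unfolding S_def using assms(2) by (intro measurable_sum_nat) auto
  have S_le: "S \<omega> \<le> n" if "\<omega> \<in> space M" for \<omega>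
  proof -
    have "S \<omega> \<le> (\<Sum>i=1..n. 1)"
      unfolding S_def using assms(3)[OF _ that] by (intro sum_mono) fastforce
    then show ?thesis by simp
  qed
  have density: "sum_density M X n k = \<P>(\<omega> in M. S \<omega> = k)" for k
    by (simp add: sum_density_def S_def)
  have zero: "sum_density M X n k = 0" if "k \<notin> {..n}" for k
  proof -
    have empty: "{\<omega> \<in> space M. S \<omega> = k} = {}"
      using S_le that by fastforce
    show ?thesis unfolding density empty by simp
  qed
  have "(\<Sum>k\<le>n. \<P>(\<omega> in M. S \<omega> = k)) = prob (\<Union>k\<le>n. {\<omega> \<in> space M. S \<omega> = k})"
    using S_meas by (intro finite_measure_finite_Union[symmetric])
      (auto simp: disjoint_family_on_def)
  also have "(\<Union>k\<le>n. {\<omega> \<in> space M. S \<omega> = k}) = space M"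
    using S_le by auto
  finally have "(\<Sum>k\<le>n. sum_density M X n k) = 1"
    by (simp add: density prob_space)
  then have "sum_density M X n sums 1"
    using sums_finite[of "{..n}" "sum_density M X n"] zero by simp
  moreover have "summable (\<lambda>k. \<bar>sum_density M X n k\<bar> * 3 ^ k)"
    by (rule summable_finite[of "{..n}"]) (auto simp: zero)
  ultimately show ?thesis
    unfolding F2_def by (auto intro!: exI[of _ "3::real"])
qed

end

theory Submission
  imports Defs
begin

text \<open>
  For a function \<open>g\<close> with generating function \<open>G\<close>, the normalized factorial moments \<open>\<mu>\<^sub>m(g)/m!\<close> are
  the Taylor coefficients of \<open>z \<mapsto> G(1 + z)\<close>. Hence \<open>d2\<close> is half of a weighted \<open>\<ell>\<^sup>1\<close> norm, with
  weights \<open>2\<^sup>m\<close>, of a difference of power series. Binomial inversion expresses \<open>g\<close> by its moments,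
  and the row sums \<open>2\<^sup>m\<close> of Pascal's triangle give \<open>dtv \<le> d2\<close> on all of \<open>F2\<close> (\<open>dtv_le_d2\<close>).

  For the second inequality the two series are \<open>F = \<Prod>\<^sub>i (1 + p\<^sub>i z)\<close> and \<open>E Q\<close>, where
  \<open>E = exp (\<lambda> z)\<close> and \<open>Q = 1 - \<lambda>\<^sub>2 z\<^sup>2/2 + \<lambda>\<^sub>3 z\<^sup>3/3 + \<lambda>\<^sub>2\<^sup>2 z\<^sup>4/8\<close>. Expanding the logarithmic
  derivative \<open>F'/F = \<Sum>\<^sub>i p\<^sub>i/(1 + p\<^sub>i z)\<close> by one more term at a time, one sees that the errors of
  the successive approximations satisfy linear equations \<open>Y' = \<lambda> Y + G\<close> in which \<open>G\<close> is built from
  earlier errors and from the products with one factor deleted. Such an equation propagates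
  coefficientwise majorants (\<open>majorized_by_linear_ode\<close>), and the deleted products are majorized by
  \<open>E\<close>. Three rounds give the majorant
  \<open>E (\<lambda>\<^sub>4 z\<^sup>4/4 + \<lambda>\<^sub>2 \<lambda>\<^sub>3 z\<^sup>5/6 + \<lambda>\<^sub>2\<^sup>3 z\<^sup>6/48)\<close> of the error (\<open>majorized_expansion_error\<close>). If
  \<open>\<lambda>\<^sub>j\<close> is given the weight \<open>j - 1\<close>, then \<open>Q\<close> is the part of weight at most 2 in the expansion of
  \<open>F/E = exp (- \<lambda>\<^sub>2 z\<^sup>2/2 + \<lambda>\<^sub>3 z\<^sup>3/3 - \<lambda>\<^sub>4 z\<^sup>4/4 + \<dots>)\<close>, and the polynomial in the majorant consists
  of the absolute values of the terms of weight 3; so the bound has the size of the first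
  neglected terms.

  It remains to evaluate the majorant at \<open>z = 2\<close>, half of the value being
  \<open>exp (2 \<lambda>) (2 \<lambda>\<^sub>4 + 8/3 \<lambda>\<^sub>2 \<lambda>\<^sub>3 + 2/3 \<lambda>\<^sub>2\<^sup>3)\<close>, and to use \<open>\<lambda>\<^sub>2 \<lambda>\<^sub>3 \<le> \<lambda> \<lambda>\<^sub>4\<close> and
  \<open>\<lambda>\<^sub>2\<^sup>3 \<le> \<lambda>\<^sup>2 \<lambda>\<^sub>4\<close>, both consequences of Chebyshev's sum inequality (\<open>power_sum_products_le\<close>).
\<close>

section \<open>Interchanging a triangular double series\<close>

text \<open>
  Fubini for double series in which the inner sum over \<open>m\<close> is finite. Both exchanges of
  summation used here, for binomial inversion and for re-expanding a generating function around 1,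
  have this triangular shape because \<open>k choose m\<close> vanishes for \<open>m > k\<close>.
\<close>

lemma sums_swap_triangle:
  fixes f :: "nat \<Rightarrow> nat \<Rightarrow> real"
  assumes zero: "\<And>m k. k < m \<Longrightarrow> f m k = 0"
    and abs_sum: "summable (\<lambda>k. \<Sum>m\<le>k. \<bar>f m k\<bar>)"
  shows "(\<lambda>m. \<Sum>k. f m k) sums (\<Sum>k. \<Sum>m\<le>k. f m k)"
proof -
  have row: "((\<lambda>m. h (f m k)) has_sum (\<Sum>m\<le>k. h (f m k))) UNIV" if "h 0 = 0"
    for h :: "real \<Rightarrow> real" and k
    by (rule has_sum_finite_neutralI) (auto simp: zero that not_le)
  have "(\<lambda>(k, m). norm (f m k)) summable_on (UNIV \<times> UNIV)"
  proof (rule summable_on_SigmaI)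
    show "(\<lambda>k. \<Sum>m\<le>k. \<bar>f m k\<bar>) summable_on UNIV"
      using abs_sum summable_on_UNIV_nonneg_real_iff[of "\<lambda>k. \<Sum>m\<le>k. \<bar>f m k\<bar>"]
      by (simp add: sum_nonneg)
    show "((\<lambda>m. case (k, m) of (k, m) \<Rightarrow> norm (f m k)) has_sum (\<Sum>m\<le>k. \<bar>f m k\<bar>)) UNIV" for k
      using row[of abs k] by simp
  qed simp
  then have "(\<lambda>p. norm (case p of (k, m) \<Rightarrow> f m k)) summable_on (UNIV \<times> UNIV)"
    by (simp only: case_prod_unfold)
  then have "(\<lambda>(k, m). f m k) summable_on (UNIV \<times> UNIV)"
    by (rule abs_summable_summable)
  then obtain S where S: "((\<lambda>(k, m). f m k) has_sum S) (UNIV \<times> UNIV)"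
    by (auto simp: summable_on_def)
  have "((\<lambda>k. \<Sum>m\<le>k. f m k) has_sum S) UNIV"
    by (rule has_sum_SigmaD[OF S]) (use row[of "\<lambda>x. x"] in auto)
  then have S_eq: "(\<Sum>k. \<Sum>m\<le>k. f m k) = S"
    by (intro sums_unique[symmetric] has_sum_imp_sums)
  have swapped: "((\<lambda>(m, k). f m k) has_sum S) (UNIV \<times> UNIV)"
    using S has_sum_swap[where f = "\<lambda>(k, m). f m k" and S = S and A = UNIV and B = UNIV] by simp
  have "((\<lambda>m. \<Sum>k. f m k) has_sum S) UNIV"
  proof (rule has_sum_SigmaD[OF swapped])
    fix m :: nat
    have "(\<lambda>k. f m k) summable_on UNIV"
      using has_sum_imp_summable[OF swapped]
      by (rule summable_on_SigmaD1[where f = f and A = UNIV and B = "\<lambda>_. UNIV"]) simp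
    then obtain s where s: "((\<lambda>k. f m k) has_sum s) UNIV"
      unfolding summable_on_def by blast
    then have "(\<Sum>k. f m k) = s"
      by (intro sums_unique[symmetric] has_sum_imp_sums)
    then show "((\<lambda>k. case (m, k) of (m, k) \<Rightarrow> f m k) has_sum (\<Sum>k. f m k)) UNIV"
      using s by simp
  qed
  then show ?thesis
    unfolding S_eq by (rule has_sum_imp_sums)
qed

section \<open>The total variation distance is at most the factorial moment distance\<close>

text \<open>
  Dividing by \<open>m!\<close> turns falling factorials into binomial coefficients, the form in which
  factorial moments can be inverted and read as Taylor coefficients.
\<close>

lemma factorial_moment_sums:
  assumes "g \<in> F2"
  shows "(\<lambda>k. real (k choose m) * g k) sums (factorial_moment m g / fact m)"
proof -
  have "(\<lambda>k. falling (k + m) m * g (k + m)) sums factorial_moment m g"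
    unfolding factorial_moment_def by (rule summable_sums) (rule summable_factorial_moment[OF assms])
  then have "(\<lambda>k. falling k m * g k) sums factorial_moment m g"
    by (subst (asm) sums_iff_shift) (simp add: falling_eq_0)
  then have "(\<lambda>k. falling k m * g k / fact m) sums (factorial_moment m g / fact m)"
    by (rule sums_divide)
  then show ?thesis
    by (simp add: falling_eq_choose)
qed

lemma choose_mult_real:
  assumes "j \<le> m" "m \<le> k"
  shows "real (m choose j) * real (k choose m) = real (k choose j) * real ((k - j) choose (m - j))"
  using choose_mult[OF assms] by (metis mult.commute of_nat_mult)

lemma binomial_inversion_kernel:
  "(\<Sum>m\<le>k. (-1) ^ (m - j) * real (m choose j) * real (k choose m)) = (if k = j then 1 else 0)"
proof (cases "j \<le> k")
  case True
  have "(\<Sum>m\<le>k. (-1) ^ (m - j) * real (m choose j) * real (k choose m))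
      = (\<Sum>m=j..k. (-1) ^ (m - j) * (real (m choose j) * real (k choose m)))"
    unfolding mult.assoc by (rule sum.mono_neutral_right) (auto simp: not_le binomial_eq_0)
  also have "\<dots> = (\<Sum>m=j..k. (-1) ^ (m - j) * (real (k choose j) * real ((k - j) choose (m - j))))"
    by (intro sum.cong refl) (simp add: choose_mult_real)
  also have "\<dots> = (\<Sum>i\<le>k - j. (-1) ^ i * (real (k choose j) * real ((k - j) choose i)))"
    by (rule sum.reindex_bij_witness[of _ "\<lambda>i. i + j" "\<lambda>m. m - j"]) (use True in auto)
  also have "\<dots> = real (k choose j) * (\<Sum>i\<le>k - j. (-1) ^ i * real ((k - j) choose i))"
    by (simp add: sum_distrib_left mult_ac)
  also have "\<dots> = (if k = j then 1 else 0)"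
    using True choose_alternating_sum[of "k - j", where 'a = real] by auto
  finally show ?thesis .
next
  case False
  then have "(\<Sum>m\<le>k. (-1) ^ (m - j) * real (m choose j) * real (k choose m)) = 0"
    by (intro sum.neutral) (auto simp: binomial_eq_0)
  then show ?thesis using False by auto
qed

lemma sum_choose_choose:
  "(\<Sum>m\<le>k. real (m choose j) * real (k choose m)) = real (k choose j) * 2 ^ (k - j)"
proof (cases "j \<le> k")
  case True
  have "(\<Sum>m\<le>k. real (m choose j) * real (k choose m))
      = (\<Sum>m=j..k. real (m choose j) * real (k choose m))"
    by (rule sum.mono_neutral_right) (auto simp: not_le binomial_eq_0)
  also have "\<dots> = (\<Sum>m=j..k. real (k choose j) * real ((k - j) choose (m - j)))"
    by (intro sum.cong refl) (simp add: choose_mult_real)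
  also have "\<dots> = (\<Sum>i\<le>k - j. real (k choose j) * real ((k - j) choose i))"
    by (rule sum.reindex_bij_witness[of _ "\<lambda>i. i + j" "\<lambda>m. m - j"]) (use True in auto)
  also have "\<dots> = real (k choose j) * real (\<Sum>i\<le>k - j. (k - j) choose i)"
    by (simp add: sum_distrib_left)
  finally show ?thesis
    by (simp only: choose_row_sum) simp
qed (simp add: binomial_eq_0)

text \<open>
  A single term of the binomial theorem. For small \<open>e > 0\<close> it shows that the factor
  \<open>k choose j\<close> costs only an arbitrarily small increase of the radius, at a price that does not depend
  on \<open>k\<close>.
\<close>

lemma choose_mult_power_le:
  fixes e :: real
  assumes "e \<ge> 0"
  shows "real (k choose j) * e ^ j \<le> (1 + e) ^ k"
proof (cases "j \<le> k")
  case True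
  have "real (k choose j) * e ^ j \<le> (\<Sum>i\<le>k. real (k choose i) * e ^ i)"
    by (rule member_le_sum) (use assms True in auto)
  also have "\<dots> = (e + 1) ^ k"
    by (simp add: binomial_ring)
  finally show ?thesis by (simp add: add.commute)
qed (use assms in \<open>simp add: binomial_eq_0\<close>)

text \<open>
  Substitute the series for the factorial moments and exchange the summations; the alternating
  sum over \<open>m\<close> then leaves only the term \<open>k = j\<close>. The exchange needs convergence of
  \<open>\<Sum>k. (k choose j) * 2 ^ (k - j) * \<bar>g k\<bar>\<close>, and this is where the radius of a function in \<open>F2\<close> has
  to exceed 2.
\<close>

lemma pmf_from_factorial_moments:
  assumes "g \<in> F2"
  shows "(\<lambda>m. (-1) ^ (m - j) * real (m choose j) * (factorial_moment m g / fact m)) sums g j"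
proof -
  obtain u where u: "u > 2" "summable (\<lambda>k. \<bar>g k\<bar> * u ^ k)"
    using assms by (auto simp: F2_def)
  \<comment> \<open>chosen so that \<open>2 * (1 + e) = u\<close>: the binomial factor is absorbed by enlarging the radius
    from 2 to \<open>u\<close>\<close>
  define e where "e = u / 2 - 1"
  have e: "e > 0" "2 * (1 + e) = u"
    using u by (auto simp: e_def)
  define f where "f m k = (-1) ^ (m - j) * real (m choose j) * (real (k choose m) * g k)" for m k
  have "(\<Sum>m\<le>k. \<bar>f m k\<bar>) \<le> (\<bar>g k\<bar> * u ^ k) / e ^ j" for k
  proof -
    have "(\<Sum>m\<le>k. \<bar>f m k\<bar>) = (\<Sum>m\<le>k. real (m choose j) * real (k choose m)) * \<bar>g k\<bar>"
      by (simp add: f_def abs_mult sum_distrib_left sum_distrib_right mult_ac)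
    also have "\<dots> = real (k choose j) * 2 ^ (k - j) * \<bar>g k\<bar>"
      by (simp only: sum_choose_choose)
    also have "\<dots> \<le> real (k choose j) * 2 ^ k * \<bar>g k\<bar>"
      by (intro mult_right_mono mult_left_mono power_increasing) auto
    also have "\<dots> = (real (k choose j) * e ^ j) * 2 ^ k * \<bar>g k\<bar> / e ^ j"
      using e by simp
    also have "\<dots> \<le> (1 + e) ^ k * 2 ^ k * \<bar>g k\<bar> / e ^ j"
      using e by (intro divide_right_mono mult_right_mono choose_mult_power_le) auto
    also have "(1 + e) ^ k * 2 ^ k = u ^ k"
      by (metis e(2) mult.commute power_mult_distrib)
    finally show ?thesis by (simp add: mult.commute)
  qed
  then have "summable (\<lambda>k. \<Sum>m\<le>k. \<bar>f m k\<bar>)"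
    by (intro summable_comparison_test'[OF summable_divide[OF u(2), of "e ^ j"]])
      (simp only: real_norm_def abs_sum_abs)
  then have "(\<lambda>m. \<Sum>k. f m k) sums (\<Sum>k. \<Sum>m\<le>k. f m k)"
    by (intro sums_swap_triangle) (auto simp: f_def binomial_eq_0)
  moreover have "(\<Sum>k. f m k) = (-1) ^ (m - j) * real (m choose j) * (factorial_moment m g / fact m)"
    for m
    unfolding f_def by (intro sums_unique[symmetric] sums_mult factorial_moment_sums assms)
  moreover have "(\<Sum>k. \<Sum>m\<le>k. f m k) = g j"
  proof -
    have "(\<Sum>m\<le>k. f m k) = (if k = j then g k else 0)" for k
    proof -
      have "(\<Sum>m\<le>k. f m k)
          = (\<Sum>m\<le>k. (-1) ^ (m - j) * real (m choose j) * real (k choose m)) * g k"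
        by (simp add: f_def sum_distrib_left sum_distrib_right mult_ac)
      then show ?thesis
        by (simp only: binomial_inversion_kernel) simp
    qed
    then show ?thesis
      using sums_unique[OF sums_single[of j g]] by simp
  qed
  ultimately show ?thesis by simp
qed

lemma factorial_moment_0:
  assumes "g \<in> F2"
  shows "factorial_moment 0 g = 1"
  using assms by (simp add: factorial_moment_def F2_def falling_def sums_iff)

lemma ennreal_abs_sums_le:
  fixes a :: "nat \<Rightarrow> real"
  assumes "a sums s"
  shows "ennreal \<bar>s\<bar> \<le> (\<Sum>m. ennreal \<bar>a m\<bar>)"
proof (cases "(\<Sum>m. ennreal \<bar>a m\<bar>) = top")
  case False
  then have summable: "summable (\<lambda>m. \<bar>a m\<bar>)"
    by (intro summable_suminf_not_top) auto
  then have "\<bar>s\<bar> \<le> (\<Sum>m. \<bar>a m\<bar>)"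
    using summable_rabs[OF summable] sums_unique[OF assms] by simp
  then have "ennreal \<bar>s\<bar> \<le> ennreal (\<Sum>m. \<bar>a m\<bar>)"
    by (rule ennreal_leI)
  also have "\<dots> = (\<Sum>m. ennreal \<bar>a m\<bar>)"
    using summable by (intro suminf_ennreal2[symmetric]) auto
  finally show ?thesis .
qed simp

text \<open>
  By binomial inversion the difference at \<open>j\<close> is bounded by the differences of the normalized
  moments weighted with \<open>m choose j\<close>, and these weights sum to \<open>2 ^ m\<close> over \<open>j\<close>. The moment of order
  0 drops out since both functions have total mass 1. All sums are nonnegative and
  extended-valued, so their order does not matter.
\<close>

lemma dtv_le_d2:
  assumes g: "g \<in> F2" and h: "h \<in> F2"
  shows "dtv g h \<le> d2 g h"
proof -
  define b where "b m = \<bar>factorial_moment m g / fact m - factorial_moment m h / fact m\<bar>" for m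
  have pointwise: "ennreal \<bar>g j - h j\<bar> \<le> (\<Sum>m. ennreal (real (m choose j) * b m))" for j
  proof -
    have "(\<lambda>m. (-1) ^ (m - j) * real (m choose j) *
        (factorial_moment m g / fact m - factorial_moment m h / fact m)) sums (g j - h j)"
      using sums_diff[OF pmf_from_factorial_moments[OF g] pmf_from_factorial_moments[OF h]]
      by (simp only: right_diff_distrib)
    from ennreal_abs_sums_le[OF this] show ?thesis
      unfolding b_def abs_mult power_abs abs_minus_cancel abs_one power_one abs_of_nat mult_1_left .
  qed
  have "(\<Sum>j. ennreal \<bar>g j - h j\<bar>) \<le> (\<Sum>j. \<Sum>m. ennreal (real (m choose j) * b m))"
    by (intro suminf_le pointwise) auto
  also have "\<dots> = (\<Sum>m. \<Sum>j. ennreal (real (m choose j) * b m))"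
    unfolding nn_integral_count_space_nat[symmetric, of "\<lambda>j. \<Sum>m. ennreal (real (m choose j) * b m)"]
    by (subst nn_integral_suminf) (auto simp: nn_integral_count_space_nat)
  also have "\<dots> = (\<Sum>m. ennreal (2 ^ m * b m))"
  proof (rule suminf_cong)
    fix m
    have "(\<Sum>j. ennreal (real (m choose j) * b m)) = (\<Sum>j\<le>m. ennreal (real (m choose j) * b m))"
      by (rule suminf_finite) (auto simp: binomial_eq_0)
    also have "\<dots> = ennreal (\<Sum>j\<le>m. real (m choose j) * b m)"
      by (rule sum_ennreal) (simp add: b_def)
    also have "(\<Sum>j\<le>m. real (m choose j) * b m) = real (\<Sum>j\<le>m. m choose j) * b m"
      by (simp add: sum_distrib_right)
    finally show "(\<Sum>j. ennreal (real (m choose j) * b m)) = ennreal (2 ^ m * b m)"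
      by (simp only: choose_row_sum) simp
  qed
  also have "\<dots> = (\<Sum>m. ennreal (2 ^ Suc m * b (Suc m))) + ennreal (2 ^ 0 * b 0)"
    using suminf_offset[of "\<lambda>m. ennreal (2 ^ m * b m)" 1] by (simp del: power_Suc add: add.commute)
  also have "b 0 = 0"
    by (simp add: b_def factorial_moment_0 g h)
  also have "(\<lambda>m. ennreal (2 ^ Suc m * b (Suc m))) = (\<lambda>m. ennreal (2 ^ Suc m / fact (Suc m) *
     \<bar>factorial_moment (Suc m) g - factorial_moment (Suc m) h\<bar>))"
    unfolding b_def diff_divide_distrib[symmetric] abs_divide by simp
  finally show ?thesis
    unfolding dtv_def d2_def by (intro divide_right_mono_ennreal) simp
qed

section \<open>Factorial moments as coefficients of the generating function at 1\<close>

text \<open>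
  The lowest nonzero coefficient would be the limit at 0 of the series divided by a power of
  \<open>x\<close>.
\<close>

lemma powser_zero_imp_coeffs_zero:
  fixes a :: "nat \<Rightarrow> real"
  assumes "s > 0" and zero: "\<And>x. \<bar>x\<bar> < s \<Longrightarrow> (\<lambda>n. a n * x ^ n) sums 0"
  shows "a m = 0"
proof (induction m rule: less_induct)
  case (less m)
  have "((\<lambda>_. 0) \<longlongrightarrow> a (0 + m)) (at (0 :: real))"
  proof (rule powser_limit_0_strong[OF \<open>s > 0\<close>])
    fix x :: real
    assume x: "x \<noteq> 0" "norm x < s"
    have "(\<lambda>n. a (n + m) * x ^ (n + m)) sums (0 - (\<Sum>i<m. a i * x ^ i))"
      by (rule sums_split_initial_segment[OF zero]) (use x in auto)
    then have "(\<lambda>n. a (n + m) * x ^ (n + m) / x ^ m) sums 0"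
      using less sums_divide[of _ 0 "x ^ m"] by simp
    then show "(\<lambda>n. a (n + m) * x ^ n) sums 0"
      using x by (simp add: power_add)
  qed
  then show ?case
    using tendsto_unique[OF at_neq_bot _ tendsto_const] by fastforce
qed

text \<open>
  Expanding \<open>(1 + z) ^ k\<close> shows that the normalized factorial moments are the Taylor
  coefficients at 1 of the probability generating function; for \<open>\<bar>z\<bar> < 1\<close> the rearrangement takes place
  inside the disc of radius 2, where \<open>g\<close> is summable.
\<close>

lemma factorial_moment_eq_fps_nth:
  fixes C :: "real fps"
  assumes g: "g \<in> F2"
    and radius: "fps_conv_radius C = \<infinity>"
    and pgf: "\<And>z. (\<lambda>k. g k * (1 + z) ^ k) sums eval_fps C z"
  shows "factorial_moment m g / fact m = fps_nth C m"
proof -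
  obtain u where u: "u > 2" "summable (\<lambda>k. \<bar>g k\<bar> * u ^ k)"
    using g by (auto simp: F2_def)
  have "(\<lambda>m. (factorial_moment m g / fact m - fps_nth C m) * z ^ m) sums 0" if z: "\<bar>z\<bar> < 1" for z
  proof -
    define f where "f m k = real (k choose m) * g k * z ^ m" for m k
    have row: "(\<Sum>m\<le>k. real (k choose m) * x ^ m) = (1 + x) ^ k" for k and x :: real
      by (simp add: binomial_ring add.commute[of 1])
    have "(\<Sum>m\<le>k. \<bar>f m k\<bar>) \<le> \<bar>g k\<bar> * u ^ k" for k
    proof -
      have "(\<Sum>m\<le>k. \<bar>f m k\<bar>) = \<bar>g k\<bar> * (1 + \<bar>z\<bar>) ^ k"
        by (simp add: f_def abs_mult power_abs sum_distrib_left mult_ac flip: row)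
      also have "\<dots> \<le> \<bar>g k\<bar> * u ^ k"
        using z u by (intro mult_left_mono power_mono) auto
      finally show ?thesis .
    qed
    then have "summable (\<lambda>k. \<Sum>m\<le>k. \<bar>f m k\<bar>)"
      by (intro summable_comparison_test'[OF u(2)]) (simp only: real_norm_def abs_sum_abs)
    then have "(\<lambda>m. \<Sum>k. f m k) sums (\<Sum>k. \<Sum>m\<le>k. f m k)"
      by (intro sums_swap_triangle) (auto simp: f_def binomial_eq_0)
    moreover have "(\<Sum>k. f m k) = factorial_moment m g / fact m * z ^ m" for m
      unfolding f_def by (intro sums_unique[symmetric] sums_mult2 factorial_moment_sums g)
    moreover have "(\<Sum>m\<le>k. f m k) = g k * (1 + z) ^ k" for k
      by (simp add: f_def sum_distrib_left mult_ac flip: row)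
    ultimately have "(\<lambda>m. factorial_moment m g / fact m * z ^ m) sums eval_fps C z"
      using sums_unique[OF pgf[of z]] by simp
    moreover have "(\<lambda>m. fps_nth C m * z ^ m) sums eval_fps C z"
      by (rule sums_eval_fps) (simp add: radius)
    ultimately show ?thesis
      using sums_diff by (fastforce simp: left_diff_distrib)
  qed
  then show ?thesis
    using powser_zero_imp_coeffs_zero[of 1 "\<lambda>m. factorial_moment m g / fact m - fps_nth C m"] by simp
qed

section \<open>Majorants of formal power series\<close>

text \<open>
  The coefficientwise majorant relation of Cauchy and Weierstrass.
\<close>

definition majorized :: "real fps \<Rightarrow> real fps \<Rightarrow> bool" where
  "majorized A B \<longleftrightarrow> (\<forall>m. \<bar>fps_nth A m\<bar> \<le> fps_nth B m)"

lemma majorized_add: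
  "majorized A B \<Longrightarrow> majorized C D \<Longrightarrow> majorized (A + C) (B + D)"
  unfolding majorized_def by (auto intro: order_trans[OF abs_triangle_ineq add_mono])

lemma majorized_uminus: "majorized A B \<Longrightarrow> majorized (- A) B"
  by (simp add: majorized_def)

lemma majorized_diff:
  "majorized A B \<Longrightarrow> majorized C D \<Longrightarrow> majorized (A - C) (B + D)"
  using majorized_add[of A B "- C" D] majorized_uminus[of C D] by simp

lemma majorized_mult:
  assumes "majorized A B" "majorized C D"
  shows "majorized (A * C) (B * D)"
  unfolding majorized_def fps_mult_nth
proof
  fix m
  have "\<bar>\<Sum>i=0..m. fps_nth A i * fps_nth C (m - i)\<bar> \<le> (\<Sum>i=0..m. \<bar>fps_nth A i * fps_nth C (m - i)\<bar>)"
    by (rule sum_abs)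
  also have "\<dots> \<le> (\<Sum>i=0..m. fps_nth B i * fps_nth D (m - i))"
    unfolding abs_mult using assms unfolding majorized_def
    by (intro sum_mono mult_mono) (auto intro: order_trans[OF abs_ge_zero])
  finally show "\<bar>\<Sum>i=0..m. fps_nth A i * fps_nth C (m - i)\<bar>
      \<le> (\<Sum>i=0..m. fps_nth B i * fps_nth D (m - i))" .
qed

lemma majorized_sum:
  "(\<And>i. i \<in> I \<Longrightarrow> majorized (A i) (B i)) \<Longrightarrow> majorized (\<Sum>i\<in>I. A i) (\<Sum>i\<in>I. B i)"
  by (induction I rule: infinite_finite_induct) (auto intro!: majorized_add simp: majorized_def[of 0])

lemma majorized_prod:
  "(\<And>i. i \<in> I \<Longrightarrow> majorized (A i) (B i)) \<Longrightarrow> majorized (\<Prod>i\<in>I. A i) (\<Prod>i\<in>I. B i)"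
  by (induction I rule: infinite_finite_induct) (auto intro!: majorized_mult simp: majorized_def[of 1])

lemma majorized_const: "0 \<le> c \<Longrightarrow> majorized (fps_const c) (fps_const c)"
  by (simp add: majorized_def)

lemma majorized_X_power: "majorized (fps_X ^ k) (fps_X ^ k)"
  by (simp add: majorized_def fps_X_power_iff)

text \<open>
  A majorant of the forcing term of a linear first-order equation yields a majorant of its
  solution: comparing coefficients, both equations are the same recursion
  \<open>(m + 1) * y (m + 1) = c * y m + g m\<close> with nonnegative multipliers. Thus estimates of solutions
  need no integral representation.
\<close>

lemma majorized_by_linear_ode:
  assumes Y: "fps_deriv Y = fps_const c * Y + G"
    and W: "fps_deriv W = fps_const c * W + H"
    and "c \<ge> 0" and GH: "majorized G H" and init: "\<bar>fps_nth Y 0\<bar> \<le> fps_nth W 0"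
  shows "majorized Y W"
proof -
  have "\<bar>fps_nth Y m\<bar> \<le> fps_nth W m" for m
  proof (induction m)
    case (Suc m)
    have "real (Suc m) * fps_nth Y (Suc m) = c * fps_nth Y m + fps_nth G m"
      using arg_cong[OF Y, of "\<lambda>A. fps_nth A m"] by simp
    then have "real (Suc m) * \<bar>fps_nth Y (Suc m)\<bar> = \<bar>c * fps_nth Y m + fps_nth G m\<bar>"
      by (metis abs_mult abs_of_nat)
    also have "\<dots> \<le> c * \<bar>fps_nth Y m\<bar> + \<bar>fps_nth G m\<bar>"
      using \<open>c \<ge> 0\<close> abs_triangle_ineq[of "c * fps_nth Y m" "fps_nth G m"] by (simp add: abs_mult)
    also have "\<dots> \<le> c * fps_nth W m + fps_nth H m"
      using Suc \<open>c \<ge> 0\<close> GH by (intro add_mono mult_left_mono) (auto simp: majorized_def)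
    also have "\<dots> = real (Suc m) * fps_nth W (Suc m)"
      using arg_cong[OF W, of "\<lambda>A. fps_nth A m"] by simp
    finally show ?case by (simp add: mult_le_cancel_left)
  qed (rule init)
  then show ?thesis by (simp add: majorized_def)
qed

text \<open>
  The distance \<open>d2\<close> is half the sum of the absolute coefficients at radius 2, without the
  constant term. A majorant with known sum therefore bounds it.
\<close>

lemma d2_le_eval_majorant:
  assumes "\<And>m. factorial_moment m g / fact m - factorial_moment m h / fact m = fps_nth D m"
    and "majorized D W" "fps_conv_radius W = \<infinity>"
  shows "d2 g h \<le> ennreal (eval_fps W 2 / 2)"
proof -
  have nonneg: "0 \<le> fps_nth W m" for m
    using assms(2) unfolding majorized_def by (meson abs_ge_zero order_trans)
  have W_sums: "(\<lambda>m. fps_nth W m * 2 ^ m) sums eval_fps W 2"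
    by (rule sums_eval_fps) (simp add: assms(3))
  have "(\<Sum>m. ennreal (2 ^ Suc m / fact (Suc m) *
      \<bar>factorial_moment (Suc m) g - factorial_moment (Suc m) h\<bar>))
      \<le> (\<Sum>m. ennreal (fps_nth W (Suc m) * 2 ^ Suc m))"
  proof (intro suminf_le ennreal_leI)
    fix m
    have "2 ^ Suc m / fact (Suc m) * \<bar>factorial_moment (Suc m) g - factorial_moment (Suc m) h\<bar>
        = \<bar>fps_nth D (Suc m)\<bar> * 2 ^ Suc m"
      unfolding assms(1)[symmetric] diff_divide_distrib[symmetric] abs_divide by simp
    also have "\<dots> \<le> fps_nth W (Suc m) * 2 ^ Suc m"
      using assms(2) by (intro mult_right_mono) (auto simp: majorized_def)
    finally show "2 ^ Suc m / fact (Suc m) * \<bar>factorial_moment (Suc m) g - factorial_moment (Suc m) h\<bar>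
        \<le> fps_nth W (Suc m) * 2 ^ Suc m" .
  qed auto
  also have "\<dots> \<le> (\<Sum>m. ennreal (fps_nth W (Suc m) * 2 ^ Suc m)) + ennreal (fps_nth W 0 * 2 ^ 0)"
    by simp
  also have "\<dots> = (\<Sum>m. ennreal (fps_nth W m * 2 ^ m))"
    using suminf_offset[of "\<lambda>m. ennreal (fps_nth W m * 2 ^ m)" 1]
    by (simp del: power_Suc add: add.commute)
  also have "\<dots> = ennreal (eval_fps W 2)"
    by (rule suminf_ennreal_eq[OF _ W_sums]) (simp add: nonneg)
  finally have "d2 g h \<le> ennreal (eval_fps W 2) / 2"
    unfolding d2_def by (rule divide_right_mono_ennreal)
  also have "\<dots> = ennreal (eval_fps W 2 / 2)"
    using sums_unique[OF W_sums] nonneg sums_summable[OF W_sums]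
    by (subst divide_ennreal[symmetric]) (auto intro!: suminf_nonneg)
  finally show ?thesis .
qed

section \<open>The generating function of a sum of independent indicators\<close>

definition bernoulli_fps :: "(nat \<Rightarrow> real) \<Rightarrow> nat set \<Rightarrow> real fps" where
  "bernoulli_fps p I = (\<Prod>i\<in>I. 1 + fps_const (p i) * fps_X)"

text \<open>
  Dividing the product by its \<open>i\<close>-th factor amounts to deleting that factor, so this is the
  product times \<open>\<Sum>i. p i ^ k / (1 + p i * X)\<close>; for \<open>k = 1\<close> the second factor is the
  logarithmic derivative of the product.
\<close>

definition deleted_sum_fps :: "(nat \<Rightarrow> real) \<Rightarrow> nat set \<Rightarrow> nat \<Rightarrow> real fps" where
  "deleted_sum_fps p I k = (\<Sum>i\<in>I. fps_const (p i ^ k) * bernoulli_fps p (I - {i}))"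

lemma bernoulli_fps_remove:
  "finite I \<Longrightarrow> i \<in> I \<Longrightarrow>
    bernoulli_fps p I = (1 + fps_const (p i) * fps_X) * bernoulli_fps p (I - {i})"
  unfolding bernoulli_fps_def by (rule prod.remove)

lemma bernoulli_fps_nth_0: "fps_nth (bernoulli_fps p I) 0 = 1"
  unfolding bernoulli_fps_def by (induction I rule: infinite_finite_induct) auto

lemma fps_deriv_bernoulli_fps:
  "finite I \<Longrightarrow> fps_deriv (bernoulli_fps p I) = deleted_sum_fps p I 1"
proof (induction I rule: finite_induct)
  case (insert j I)
  have delete: "bernoulli_fps p (insert j I - {i}) = (1 + fps_const (p j) * fps_X) * bernoulli_fps p (I - {i})"
    if "i \<in> I" for i
  proof -
    have "insert j I - {i} = insert j (I - {i})"
      using that insert by auto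
    then show ?thesis
      using insert by (simp add: bernoulli_fps_def)
  qed
  have "deleted_sum_fps p (insert j I) 1
      = fps_const (p j) * bernoulli_fps p I + (1 + fps_const (p j) * fps_X) * deleted_sum_fps p I 1"
    using insert by (simp add: deleted_sum_fps_def sum_distrib_left delete mult_ac)
  moreover have "bernoulli_fps p (insert j I) = (1 + fps_const (p j) * fps_X) * bernoulli_fps p I"
    using insert by (simp add: bernoulli_fps_def)
  ultimately show ?case
    using insert.IH by (simp add: algebra_simps)
qed (simp add: bernoulli_fps_def deleted_sum_fps_def)

lemma fps_const_sum: "fps_const (\<Sum>i\<in>I. c i) = (\<Sum>i\<in>I. fps_const (c i))"
  by (induction I rule: infinite_finite_induct) (auto simp flip: fps_const_add)

text \<open>
  This is the identity \<open>1 / (1 + t) = 1 - t / (1 + t)\<close> with \<open>t = p i * X\<close>, multiplied by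
  \<open>p i ^ k\<close> and summed. Each application peels one power sum off the logarithmic derivative and
  leaves a remainder one order smaller.
\<close>

lemma deleted_sum_fps_step:
  assumes "finite I"
  shows "deleted_sum_fps p I k
    = fps_const (\<Sum>i\<in>I. p i ^ k) * bernoulli_fps p I - fps_X * deleted_sum_fps p I (Suc k)"
proof -
  have "fps_const (p i ^ k) * bernoulli_fps p I - fps_X * (fps_const (p i ^ Suc k) * bernoulli_fps p (I - {i}))
      = fps_const (p i ^ k) * bernoulli_fps p (I - {i})" if "i \<in> I" for i
    unfolding bernoulli_fps_remove[OF assms that]
    by (simp add: algebra_simps flip: fps_const_mult)
  then show ?thesis
    by (simp add: deleted_sum_fps_def sum_distrib_left sum_distrib_right fps_const_sum flip: sum_subtractf)
qed

text \<open>
  The factors \<open>1 + p i * X\<close> are partial sums of \<open>exp (p i * X)\<close>. Deleted factors are replaced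
  by 1, which the exponential majorizes too.
\<close>

lemma majorized_bernoulli_exp:
  assumes nonneg: "\<And>i. i \<in> J \<Longrightarrow> 0 \<le> p i" and "finite J" "I \<subseteq> J"
  shows "majorized (bernoulli_fps p I) (fps_exp (\<Sum>i\<in>J. p i))"
proof -
  have factor: "majorized (1 + fps_const (p i) * fps_X) (fps_exp (p i))"
    and one: "majorized 1 (fps_exp (p i))" if "i \<in> J" for i
    using nonneg[OF that] by (auto simp: majorized_def fps_X_def)
  have "bernoulli_fps p I = (\<Prod>i\<in>J. if i \<in> I then 1 + fps_const (p i) * fps_X else 1)"
    using assms unfolding bernoulli_fps_def
    by (simp add: prod.inter_restrict[symmetric] Int_absorb1)
  moreover have "majorized \<dots> (\<Prod>i\<in>J. fps_exp (p i))"
    by (intro majorized_prod) (auto intro: factor one)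
  moreover have "(\<Prod>i\<in>J. fps_exp (p i)) = fps_exp (\<Sum>i\<in>J. p i)"
    using \<open>finite J\<close> by (induction J rule: finite_induct) (auto simp: fps_exp_add_mult)
  ultimately show ?thesis by simp
qed

lemma majorized_deleted_sum:
  assumes nonneg: "\<And>i. i \<in> I \<Longrightarrow> 0 \<le> p i" and "finite I"
  shows "majorized (deleted_sum_fps p I k) (fps_const (\<Sum>i\<in>I. p i ^ k) * fps_exp (\<Sum>i\<in>I. p i))"
proof -
  have "majorized (deleted_sum_fps p I k) (\<Sum>i\<in>I. fps_const (p i ^ k) * fps_exp (\<Sum>i\<in>I. p i))"
    unfolding deleted_sum_fps_def using assms
    by (intro majorized_sum majorized_mult majorized_const majorized_bernoulli_exp) auto
  then show ?thesis
    by (simp add: fps_const_sum sum_distrib_right)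
qed

section \<open>The error of the third order expansion\<close>

text \<open>
  Products \<open>exp (a * X) * c * X ^ (k + 1)\<close> solve the equation \<open>W' = a * W + H\<close> for a forcing
  term \<open>H\<close> of the same kind; combinations of them serve as majorants in the comparison lemma.
\<close>

lemma fps_deriv_exp_mult_power:
  fixes a c :: real
  shows "fps_deriv (fps_exp a * (fps_const c * fps_X ^ Suc k))
    = fps_const a * (fps_exp a * (fps_const c * fps_X ^ Suc k))
      + fps_X ^ k * (fps_const (real (Suc k) * c) * fps_exp a)"
proof -
  have "fps_deriv (fps_X ^ Suc k :: real fps) = fps_const (real (Suc k)) * fps_X ^ k"
    by (simp only: fps_deriv_power) (simp add: fps_of_nat)
  then show ?thesis
    unfolding fps_const_mult[symmetric]
    by (simp only: fps_deriv_mult fps_exp_deriv fps_deriv_const)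
      (simp only: mult_ac mult_zero_left mult_zero_right add_0_left add_0_right add_ac)
qed

text \<open>
  The terms of weight at most 2 of \<open>exp (- l2 * X^2 / 2 + l3 * X^3 / 3)\<close>, where \<open>l2\<close> has weight 1
  and \<open>l3\<close> has weight 2.
\<close>

definition expansion_poly :: "real \<Rightarrow> real \<Rightarrow> real fps" where
  "expansion_poly l2 l3 = 1 - fps_const (l2 / 2) * fps_X ^ 2 + fps_const (l3 / 3) * fps_X ^ 3
     + fps_const (l2 ^ 2 / 8) * fps_X ^ 4"

text \<open>
  Write \<open>F\<close> for the product and \<open>E\<close> for \<open>exp (l 1 * X)\<close>. The partial expansions are handled one
  order at a time: \<open>Y1\<close>, \<open>Y2\<close> and \<open>Y3\<close> are the errors of \<open>E\<close>, of \<open>E * (1 - l 2 * X^2 / 2)\<close> and of the full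
  approximation. Each solves \<open>Y' = l 1 * Y + G\<close> where \<open>G\<close> involves only the earlier errors and a
  remainder \<open>S k\<close>, and all of these have majorants of the form \<open>E\<close> times a polynomial. Since the
  factor \<open>E\<close> is reproduced at each stage and never squared, the exponential enters the bound only
  once.
\<close>

lemma majorized_expansion_error:
  fixes p :: "nat \<Rightarrow> real"
  assumes nonneg: "\<And>i. i \<in> I \<Longrightarrow> 0 \<le> p i" and "finite I"
  defines "l \<equiv> \<lambda>k. \<Sum>i\<in>I. p i ^ k"
  shows "majorized (bernoulli_fps p I - fps_exp (l 1) * expansion_poly (l 2) (l 3))
    (fps_exp (l 1) * (fps_const (l 4 / 4) * fps_X ^ 4 + fps_const (l 2 * l 3 / 6) * fps_X ^ 5
       + fps_const (l 2 ^ 3 / 48) * fps_X ^ 6))"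
proof -
  define F where "F = bernoulli_fps p I"
  define E where "E = fps_exp (l 1)"
  define S where "S = deleted_sum_fps p I"
  define Y1 where "Y1 = F - E"
  define Y2 where "Y2 = F - E * (1 - fps_const (l 2 / 2) * fps_X ^ 2)"
  define Y3 where "Y3 = F - E * expansion_poly (l 2) (l 3)"
  have l_nonneg: "l k \<ge> 0" for k
    unfolding l_def by (intro sum_nonneg zero_le_power nonneg)
  have dE: "fps_deriv E = fps_const (l 1) * E"
    by (simp add: E_def)
  have dF: "fps_deriv F = S 1"
    using \<open>finite I\<close> by (simp add: F_def S_def fps_deriv_bernoulli_fps)
  have step: "S k = fps_const (l k) * F - fps_X * S (Suc k)" for k
    using \<open>finite I\<close> unfolding S_def F_def l_def by (rule deleted_sum_fps_step)
  have S_maj: "majorized (S k) (fps_const (l k) * E)" for k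
    using majorized_deleted_sum[where p = p and k = k, OF nonneg \<open>finite I\<close>]
    by (simp add: S_def E_def l_def)
  have nth0: "fps_nth F 0 = 1" "fps_nth E 0 = 1"
    by (simp_all add: F_def E_def bernoulli_fps_nth_0)
  \<comment> \<open>the correction terms, up to sign; \<open>T4\<close> is normalized so that its forcing term is
    \<open>l 2 * X * T2\<close>, the second-order effect of the quadratic correction\<close>
  define T2 where "T2 = E * (fps_const (l 2 / 2) * fps_X ^ Suc 1)"
  define T3 where "T3 = E * (fps_const (l 3 / 3) * fps_X ^ Suc 2)"
  define T4 where "T4 = E * (fps_const (l 2 ^ 2 / 8) * fps_X ^ Suc 3)"
  have dT: "fps_deriv T2 = fps_const (l 1) * T2 + fps_X ^ 1 * (fps_const (l 2) * E)"
    "fps_deriv T3 = fps_const (l 1) * T3 + fps_X ^ 2 * (fps_const (l 3) * E)"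
    "fps_deriv T4 = fps_const (l 1) * T4 + fps_X ^ 3 * (fps_const (l 2 ^ 2 / 2) * E)"
    unfolding T2_def T3_def T4_def E_def fps_deriv_exp_mult_power by simp_all
  have T_0: "fps_nth T2 0 = 0" "fps_nth T3 0 = 0" "fps_nth T4 0 = 0"
    by (simp_all add: T2_def T3_def T4_def)
  have c22: "fps_const (l 2 ^ 2 / 2) = fps_const (l 2) * fps_const (l 2 / 2)"
    by (simp add: power2_eq_square)
  define Y1 where "Y1 = F - E"
  define Y2 where "Y2 = Y1 + T2"
  define Y3 where "Y3 = Y2 - T3 - T4"
  have S1: "S 1 = fps_const (l 1) * F - fps_X * S 2"
    and S2: "S 2 = fps_const (l 2) * F - fps_X * S 3"
    and S3: "S 3 = fps_const (l 3) * F - fps_X * S 4"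
    using step[of 1] step[of 2] step[of 3] by (simp_all add: eval_nat_numeral)
  have dY1: "fps_deriv Y1 = fps_const (l 1) * Y1 + - (fps_X ^ 1 * S 2)"
    unfolding Y1_def fps_deriv_sub dF dE S1 by (simp add: algebra_simps)
  have dY2: "fps_deriv Y2 = fps_const (l 1) * Y2
      + (fps_X ^ 2 * S 3 - fps_const (l 2) * fps_X ^ 1 * Y1)"
    unfolding Y2_def fps_deriv_add dY1 dT S2 unfolding Y1_def
    by (simp add: algebra_simps power2_eq_square del: fps_const_mult)
  have dY3: "fps_deriv Y3 = fps_const (l 1) * Y3
      + (fps_const (l 3) * fps_X ^ 2 * Y1 - fps_const (l 2) * fps_X ^ 1 * Y2 - fps_X ^ 3 * S 4)"
    unfolding Y3_def fps_deriv_sub dY2 dT S3 c22 unfolding Y2_def Y1_def T2_def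
    by (simp add: algebra_simps power2_eq_square power3_eq_cube del: fps_const_mult)
  have maj1: "majorized Y1 T2"
    by (rule majorized_by_linear_ode[OF dY1 dT(1) l_nonneg])
      (intro majorized_uminus majorized_mult majorized_X_power S_maj, simp add: Y1_def nth0 T_0)
  have maj2: "majorized Y2 (T3 + T4)"
  proof (rule majorized_by_linear_ode[OF dY2 _ l_nonneg])
    show "fps_deriv (T3 + T4) = fps_const (l 1) * (T3 + T4)
        + (fps_X ^ 2 * (fps_const (l 3) * E) + fps_const (l 2) * fps_X ^ 1 * T2)"
      unfolding fps_deriv_add dT c22 unfolding T2_def
      by (simp add: algebra_simps power2_eq_square power3_eq_cube del: fps_const_mult)
    show "majorized (fps_X ^ 2 * S 3 - fps_const (l 2) * fps_X ^ 1 * Y1)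
        (fps_X ^ 2 * (fps_const (l 3) * E) + fps_const (l 2) * fps_X ^ 1 * T2)"
      by (intro majorized_diff majorized_mult majorized_const majorized_X_power S_maj maj1 l_nonneg)
  qed (simp add: Y2_def Y1_def nth0 T_0)
  \<comment> \<open>the coefficients solve \<open>W' = l 1 * W + H\<close> exactly for the forcing majorant \<open>H\<close> of \<open>Y3\<close>;
    the factor 5/6 below is \<open>1/2 + 1/3\<close>, from \<open>l 3 * Y1\<close> and from \<open>l 2 * Y2\<close>\<close>
  define U4 where "U4 = E * (fps_const (l 4 / 4) * fps_X ^ Suc 3)"
  define U5 where "U5 = E * (fps_const (l 2 * l 3 / 6) * fps_X ^ Suc 4)"
  define U6 where "U6 = E * (fps_const (l 2 ^ 3 / 48) * fps_X ^ Suc 5)"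
  have dU: "fps_deriv U4 = fps_const (l 1) * U4 + fps_X ^ 3 * (fps_const (l 4) * E)"
    "fps_deriv U5 = fps_const (l 1) * U5 + fps_X ^ 4 * (fps_const (5 * (l 2 * l 3) / 6) * E)"
    "fps_deriv U6 = fps_const (l 1) * U6 + fps_X ^ 5 * (fps_const (l 2 ^ 3 / 8) * E)"
    unfolding U4_def U5_def U6_def E_def fps_deriv_exp_mult_power by simp_all
  have c23: "fps_const (5 * (l 2 * l 3) / 6)
      = fps_const (l 3) * fps_const (l 2 / 2) + fps_const (l 2) * fps_const (l 3 / 3)"
    and c222: "fps_const (l 2 ^ 3 / 8) = fps_const (l 2) * fps_const (l 2 ^ 2 / 8)"
    by (simp_all add: power2_eq_square power3_eq_cube)
  have maj3: "majorized Y3 (U4 + U5 + U6)"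
  proof (rule majorized_by_linear_ode[OF dY3 _ l_nonneg])
    show "fps_deriv (U4 + U5 + U6) = fps_const (l 1) * (U4 + U5 + U6)
        + (fps_const (l 3) * fps_X ^ 2 * T2 + fps_const (l 2) * fps_X ^ 1 * (T3 + T4)
           + fps_X ^ 3 * (fps_const (l 4) * E))"
      unfolding fps_deriv_add dU c23 c222 unfolding T2_def T3_def T4_def
      by (simp add: algebra_simps eval_nat_numeral del: fps_const_mult fps_const_add)
    show "majorized
        (fps_const (l 3) * fps_X ^ 2 * Y1 - fps_const (l 2) * fps_X ^ 1 * Y2 - fps_X ^ 3 * S 4)
        (fps_const (l 3) * fps_X ^ 2 * T2 + fps_const (l 2) * fps_X ^ 1 * (T3 + T4)
           + fps_X ^ 3 * (fps_const (l 4) * E))"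
      by (intro majorized_diff majorized_mult majorized_const majorized_X_power S_maj maj1 maj2 l_nonneg)
  qed (simp add: Y3_def Y2_def Y1_def U4_def U5_def U6_def nth0 T_0)
  moreover have "Y3 = F - E * expansion_poly (l 2) (l 3)"
    by (simp add: Y3_def Y2_def Y1_def T2_def T3_def T4_def expansion_poly_def algebra_simps eval_nat_numeral
        del: fps_const_mult)
  moreover have "U4 + U5 + U6 = E * (fps_const (l 4 / 4) * fps_X ^ 4
      + fps_const (l 2 * l 3 / 6) * fps_X ^ 5 + fps_const (l 2 ^ 3 / 48) * fps_X ^ 6)"
    by (simp add: U4_def U5_def U6_def algebra_simps eval_nat_numeral del: fps_const_mult)
  ultimately show ?thesis
    by (simp only: F_def E_def)
qed

text \<open>
  Chebyshev's sum inequality with weights \<open>p i\<close>: the sequences \<open>p i ^ a\<close> and \<open>p i ^ b\<close> are ordered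
  alike, so the double sum of \<open>p i * p j * (p i ^ a - p j ^ a) * (p i ^ b - p j ^ b)\<close> is
  nonnegative.
\<close>

lemma power_sum_products_le:
  fixes p :: "nat \<Rightarrow> real"
  assumes nonneg: "\<And>i. i \<in> I \<Longrightarrow> 0 \<le> p i"
  shows "(\<Sum>i\<in>I. p i ^ Suc a) * (\<Sum>i\<in>I. p i ^ Suc b) \<le> (\<Sum>i\<in>I. p i) * (\<Sum>i\<in>I. p i ^ Suc (a + b))"
proof -
  define w where "w i j = p i * p j * ((p i ^ a - p j ^ a) * (p i ^ b - p j ^ b))" for i j
  have "0 \<le> w i j" if "i \<in> I" "j \<in> I" for i j
  proof -
    have "0 \<le> (p i ^ a - p j ^ a) * (p i ^ b - p j ^ b)"
      using nonneg[OF that(1)] nonneg[OF that(2)]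
      by (cases "p i \<le> p j") (simp_all add: power_mono mult_nonneg_nonneg mult_nonpos_nonpos)
    then show ?thesis
      using nonneg that by (simp add: w_def)
  qed
  then have "0 \<le> (\<Sum>i\<in>I. \<Sum>j\<in>I. w i j)"
    by (intro sum_nonneg)
  also have "\<dots> = (\<Sum>i\<in>I. \<Sum>j\<in>I. p i ^ Suc (a + b) * p j) + (\<Sum>i\<in>I. \<Sum>j\<in>I. p i * p j ^ Suc (a + b))
      - (\<Sum>i\<in>I. \<Sum>j\<in>I. p i ^ Suc a * p j ^ Suc b) - (\<Sum>i\<in>I. \<Sum>j\<in>I. p i ^ Suc b * p j ^ Suc a)"
    unfolding sum.distrib[symmetric] sum_subtractf[symmetric]
    by (intro sum.cong refl) (simp add: w_def algebra_simps power_add)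
  also have "\<dots> = 2 * ((\<Sum>i\<in>I. p i) * (\<Sum>i\<in>I. p i ^ Suc (a + b)) - (\<Sum>i\<in>I. p i ^ Suc a) * (\<Sum>i\<in>I. p i ^ Suc b))"
    unfolding sum_product[symmetric] by (simp only: algebra_simps)
  finally show ?thesis by simp
qed

section \<open>Generating functions of the two distributions\<close>

lemma entire_fps_mult [simp]:
  fixes f g :: "real fps"
  shows "fps_conv_radius f = \<infinity> \<Longrightarrow> fps_conv_radius g = \<infinity> \<Longrightarrow> fps_conv_radius (f * g) = \<infinity>"
  using fps_conv_radius_mult[of f g] by simp

lemma entire_fps_add [simp]:
  fixes f g :: "real fps"
  shows "fps_conv_radius f = \<infinity> \<Longrightarrow> fps_conv_radius g = \<infinity> \<Longrightarrow> fps_conv_radius (f + g) = \<infinity>"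
  using fps_conv_radius_add[of f g] by simp

lemma entire_fps_diff [simp]:
  fixes f g :: "real fps"
  shows "fps_conv_radius f = \<infinity> \<Longrightarrow> fps_conv_radius g = \<infinity> \<Longrightarrow> fps_conv_radius (f - g) = \<infinity>"
  using fps_conv_radius_diff[of f g] by simp

lemma bernoulli_fps_entire: "fps_conv_radius (bernoulli_fps p I) = \<infinity>"
  unfolding bernoulli_fps_def by (induction I rule: infinite_finite_induct) auto

lemma eval_bernoulli_fps: "eval_fps (bernoulli_fps p I) z = (\<Prod>i\<in>I. 1 + p i * z)"
proof (induction I rule: infinite_finite_induct)
  case (insert i I)
  have "bernoulli_fps p (insert i I) = (1 + fps_const (p i) * fps_X) * bernoulli_fps p I"
    using insert by (simp add: bernoulli_fps_def)
  then show ?case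
    using insert by (simp add: eval_fps_mult eval_fps_add bernoulli_fps_entire)
qed (simp_all add: bernoulli_fps_def)

lemma expansion_poly_entire: "fps_conv_radius (expansion_poly l2 l3) = \<infinity>"
  by (simp add: expansion_poly_def)

lemma eval_expansion_poly:
  "eval_fps (expansion_poly l2 l3) z = 1 - l2 / 2 * z ^ 2 + l3 / 3 * z ^ 3 + l2 ^ 2 / 8 * z ^ 4"
  by (simp add: expansion_poly_def eval_fps_mult eval_fps_add eval_fps_diff)

text \<open>
  The generating function at \<open>1 + z\<close> is the expectation of \<open>(1 + z) ^ S\<close>; by independence it factors
  into the expectations of \<open>(1 + z) ^ X i = 1 + z * X i\<close>.
\<close>

lemma sum_density_pgf:
  assumes "prob_space M"
    and indep: "prob_space.indep_vars M (\<lambda>_. count_space UNIV) X {1..n}"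
    and binary: "\<And>i \<omega>. i \<in> {1..n} \<Longrightarrow> \<omega> \<in> space M \<Longrightarrow> X i \<omega> \<in> {0, 1}"
    and p: "\<And>i. i \<in> {1..n} \<Longrightarrow> p i = \<P>(\<omega> in M. X i \<omega> = 1)"
  shows "(\<lambda>k. sum_density M X n k * (1 + z) ^ k) sums eval_fps (bernoulli_fps p {1..n}) z"
proof -
  interpret prob_space M by fact
  have meas: "X i \<in> measurable M (count_space UNIV)" if "i \<in> {1..n}" for i
    using indep that by (auto simp: indep_vars_def)
  define S where "S \<omega> = (\<Sum>i=1..n. X i \<omega>)" for \<omega>
  have S_meas [measurable]: "S \<in> measurable M (count_space UNIV)"
    unfolding S_def using meas by (intro measurable_sum_nat) auto
  have S_le: "S \<omega> \<le> n" if "\<omega> \<in> space M" for \<omega>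
  proof -
    have "S \<omega> \<le> (\<Sum>i=1..n. 1)"
      unfolding S_def using binary[OF _ that] by (intro sum_mono) fastforce
    then show ?thesis by simp
  qed
  have density: "sum_density M X n k = measure M {\<omega> \<in> space M. S \<omega> = k}" for k
    by (simp add: sum_density_def S_def)
  have zero: "sum_density M X n k = 0" if "k \<notin> {..n}" for k
  proof -
    have empty: "{\<omega> \<in> space M. S \<omega> = k} = {}"
      using S_le that by fastforce
    show ?thesis unfolding density empty by simp
  qed
  have factor: "(1 + z) ^ X i \<omega> = 1 + z * indicator {\<omega> \<in> space M. X i \<omega> = 1} \<omega>"
    if "i \<in> {1..n}" "\<omega> \<in> space M" for i \<omega>
    using binary[OF that] that(2) by (auto simp: indicator_def)
  have event: "{\<omega> \<in> space M. X i \<omega> = 1} \<in> events" if "i \<in> {1..n}" for i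
    using meas[OF that] by measurable
  have event_int: "integrable M (indicator {\<omega> \<in> space M. X i \<omega> = 1} :: 'a \<Rightarrow> real)" if "i \<in> {1..n}" for i
    using event[OF that] by (intro integrable_real_indicator) (auto simp: less_top[symmetric])
  have factor_int: "integrable M (\<lambda>\<omega>. (1 + z) ^ X i \<omega>)" if "i \<in> {1..n}" for i
    using event_int[OF that]
    by (subst Bochner_Integration.integrable_cong[OF refl factor[OF that]]) auto
  have factor_expectation: "expectation (\<lambda>\<omega>. (1 + z) ^ X i \<omega>) = 1 + p i * z" if "i \<in> {1..n}" for i
    using event[OF that] event_int[OF that] p[OF that]
    by (subst Bochner_Integration.integral_cong[OF refl factor[OF that]]) (auto simp: prob_space)
  have "indep_vars (\<lambda>_. borel) (\<lambda>i \<omega>. (1 + z) ^ X i \<omega>) {1..n}"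
    by (rule indep_vars_compose2[OF indep]) simp
  then have "expectation (\<lambda>\<omega>. \<Prod>i\<in>{1..n}. (1 + z) ^ X i \<omega>) = (\<Prod>i\<in>{1..n}. 1 + p i * z)"
    using factor_int factor_expectation by (subst indep_vars_lebesgue_integral) auto
  moreover have "expectation (\<lambda>\<omega>. \<Prod>i\<in>{1..n}. (1 + z) ^ X i \<omega>)
      = expectation (\<lambda>\<omega>. \<Sum>k\<le>n. indicator {\<omega> \<in> space M. S \<omega> = k} \<omega> * (1 + z) ^ k)"
  proof (rule Bochner_Integration.integral_cong[OF refl])
    fix \<omega> assume \<omega>: "\<omega> \<in> space M"
    have "(\<Sum>k\<le>n. indicator {\<omega> \<in> space M. S \<omega> = k} \<omega> * (1 + z) ^ k)
        = (\<Sum>k\<le>n. if k = S \<omega> then (1 + z) ^ k else 0)"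
      by (intro sum.cong refl) (auto simp: \<omega> indicator_def)
    also have "\<dots> = (1 + z) ^ S \<omega>"
      using S_le[OF \<omega>] by simp
    finally show "(\<Prod>i\<in>{1..n}. (1 + z) ^ X i \<omega>)
        = (\<Sum>k\<le>n. indicator {\<omega> \<in> space M. S \<omega> = k} \<omega> * (1 + z) ^ k)"
      by (simp add: S_def power_sum)
  qed
  moreover have "\<dots> = (\<Sum>k\<le>n. sum_density M X n k * (1 + z) ^ k)"
  proof (subst Bochner_Integration.integral_sum)
    show "integrable M (\<lambda>\<omega>. indicator {\<omega> \<in> space M. S \<omega> = k} \<omega> * (1 + z) ^ k)" for k
      by (intro integrable_mult_left integrable_real_indicator) (auto simp: less_top[symmetric])
  qed (simp add: density)
  moreover have "(\<lambda>k. sum_density M X n k * (1 + z) ^ k) sums (\<Sum>k\<le>n. sum_density M X n k * (1 + z) ^ k)"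
    by (rule sums_finite) (auto simp: zero)
  ultimately show ?thesis
    by (simp add: eval_bernoulli_fps)
qed

text \<open>
  A Charlier polynomial of degree \<open>m\<close> against the Poisson weights contributes
  \<open>(l * z) ^ m * exp (l * z)\<close>, so the powers of \<open>l\<close> in the denominators cancel.
\<close>

lemma phi3_pgf:
  assumes "power_sum p n 1 \<noteq> 0"
  shows "(\<lambda>k. phi3 p n k * (1 + z) ^ k) sums
    eval_fps (fps_exp (power_sum p n 1) * expansion_poly (power_sum p n 2) (power_sum p n 3)) z"
proof -
  define l where "l = power_sum p n 1"
  define l2 where "l2 = power_sum p n 2"
  define l3 where "l3 = power_sum p n 3"
  have l_nonzero: "l \<noteq> 0"
    using assms by (simp add: l_def)
  define w where "w m k = exp (- l) * l ^ k / fact k * charlier l m k * (1 + z) ^ k" for m k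
  have w: "w m sums ((l * z) ^ m * exp (l * z))" for m
    using poisson_charlier_sums[of l m "1 + z"] by (simp add: w_def[abs_def])
  have "charlier l 0 k = 1" for k
    by (simp add: charlier_def falling_def)
  moreover have "phi3 p n k = exp (- l) * l ^ k / fact k * (1 - l2 / (2 * l ^ 2) * charlier l 2 k
      + l3 / (3 * l ^ 3) * charlier l 3 k + l2 ^ 2 / (8 * l ^ 4) * charlier l 4 k)" for k
    unfolding phi3_def Let_def l_def l2_def l3_def by (rule refl)
  ultimately have "phi3 p n k * (1 + z) ^ k = w 0 k - l2 / (2 * l ^ 2) * w 2 k
      + l3 / (3 * l ^ 3) * w 3 k + l2 ^ 2 / (8 * l ^ 4) * w 4 k" for k
    by (simp only:) (simp add: w_def algebra_simps)
  then have "(\<lambda>k. phi3 p n k * (1 + z) ^ k) sums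
      ((l * z) ^ 0 * exp (l * z) - l2 / (2 * l ^ 2) * ((l * z) ^ 2 * exp (l * z))
      + l3 / (3 * l ^ 3) * ((l * z) ^ 3 * exp (l * z))
      + l2 ^ 2 / (8 * l ^ 4) * ((l * z) ^ 4 * exp (l * z)))"
    by (simp only:) (intro sums_add sums_diff sums_mult w)
  also have "((l * z) ^ 0 * exp (l * z) - l2 / (2 * l ^ 2) * ((l * z) ^ 2 * exp (l * z))
      + l3 / (3 * l ^ 3) * ((l * z) ^ 3 * exp (l * z))
      + l2 ^ 2 / (8 * l ^ 4) * ((l * z) ^ 4 * exp (l * z)))
      = eval_fps (fps_exp l * expansion_poly l2 l3) z"
    using l_nonzero by (simp add: eval_fps_mult expansion_poly_entire eval_expansion_poly
        power_mult_distrib field_simps)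
  finally show ?thesis
    by (simp add: l_def l2_def l3_def)
qed

section \<open>The bound\<close>

theorem theorem3p2:
  fixes M :: "'a measure" and X :: "nat \<Rightarrow> 'a \<Rightarrow> nat" and p :: "nat \<Rightarrow> real" and n :: nat
    and l :: real
  assumes "prob_space M"
    and "n \<ge> 1"
    and "prob_space.indep_vars M (\<lambda>_. count_space UNIV) X {1..n}"
    and "\<And>i \<omega>. i \<in> {1..n} \<Longrightarrow> \<omega> \<in> space M \<Longrightarrow> X i \<omega> \<in> {0, 1}"
    and "\<And>i. i \<in> {1..n} \<Longrightarrow> p i = \<P>(\<omega> in M. X i \<omega> = 1)"
    and "l = (\<Sum>i=1..n. p i)"
    and "l > 0"
  shows "dtv (sum_density M X n) (phi3 p n) \<le> d2 (sum_density M X n) (phi3 p n)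
    \<and> d2 (sum_density M X n) (phi3 p n)
        \<le> ennreal (2 / 3 * (l ^ 2 + 4 * l + 3) * exp (2 * l) * (\<Sum>i=1..n. p i ^ 4))"
proof
  have "X i \<in> measurable M (count_space UNIV)" if "i \<in> {1..n}" for i
    using assms(3) that unfolding prob_space.indep_vars_def[OF assms(1)] by auto
  with assms(1,4) have f_F2: "sum_density M X n \<in> F2"
    by (intro sum_density_in_F2)
  then show "dtv (sum_density M X n) (phi3 p n) \<le> d2 (sum_density M X n) (phi3 p n)"
    by (rule dtv_le_d2) (rule phi3_in_F2)
  have nonneg: "0 \<le> p i" if "i \<in> {1..n}" for i
    using assms(5)[OF that] by simp
  have l: "power_sum p n 1 = l"
    by (simp add: power_sum_def assms(6))
  define l2 where "l2 = power_sum p n 2"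
  define l3 where "l3 = power_sum p n 3"
  define l4 where "l4 = power_sum p n 4"
  define W where "W = fps_exp l * (fps_const (l4 / 4) * fps_X ^ 4
    + fps_const (l2 * l3 / 6) * fps_X ^ 5 + fps_const (l2 ^ 3 / 48) * fps_X ^ 6)"
  have "majorized (bernoulli_fps p {1..n} - fps_exp l * expansion_poly l2 l3) W"
    using majorized_expansion_error[where p = p and I = "{1..n}", OF nonneg]
    by (simp add: W_def l2_def l3_def l4_def power_sum_def assms(6))
  moreover have "factorial_moment m (sum_density M X n) / fact m = fps_nth (bernoulli_fps p {1..n}) m" for m
    by (intro factorial_moment_eq_fps_nth f_F2 bernoulli_fps_entire sum_density_pgf assms)
  moreover have "factorial_moment m (phi3 p n) / fact m = fps_nth (fps_exp l * expansion_poly l2 l3) m" for m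
    using assms(7) phi3_pgf[of p n] unfolding l l2_def l3_def
    by (intro factorial_moment_eq_fps_nth phi3_in_F2) (simp_all add: expansion_poly_entire)
  ultimately have "d2 (sum_density M X n) (phi3 p n) \<le> ennreal (eval_fps W 2 / 2)"
    by (intro d2_le_eval_majorant) (simp_all add: W_def)
  also have "eval_fps W 2 / 2 = exp (2 * l) * (2 * l4 + 8 / 3 * (l2 * l3) + 2 / 3 * l2 ^ 3)"
    by (simp add: W_def eval_fps_mult eval_fps_add field_simps)
  also have "\<dots> \<le> exp (2 * l) * (2 * l4 + 8 / 3 * (l * l4) + 2 / 3 * (l ^ 2 * l4))"
  proof -
    have l23: "l2 * l3 \<le> l * l4" and l22: "l2 * l2 \<le> l * l3"
      using power_sum_products_le[of "{1..n}" p 1 2] power_sum_products_le[of "{1..n}" p 1 1] nonneg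
      by (simp_all add: l2_def l3_def l4_def power_sum_def assms(6) eval_nat_numeral)
    have "l2 \<ge> 0"
      unfolding l2_def power_sum_def using nonneg by (intro sum_nonneg) simp
    then have "l2 ^ 3 \<le> l2 * (l * l3)"
      using mult_left_mono[OF l22, of l2] by (simp add: power3_eq_cube)
    also have "\<dots> \<le> l * (l * l4)"
      using mult_left_mono[OF l23, of l] assms(7) by (simp add: mult_ac)
    finally have "l2 ^ 3 \<le> l ^ 2 * l4"
      by (simp add: power2_eq_square mult.assoc)
    with l23 show ?thesis
      by (intro mult_left_mono add_mono) auto
  qed
  also have "\<dots> = 2 / 3 * (l ^ 2 + 4 * l + 3) * exp (2 * l) * (\<Sum>i=1..n. p i ^ 4)"
    by (simp add: l4_def power_sum_def algebra_simps)
  finally show "d2 (sum_density M X n) (phi3 p n)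
        \<le> ennreal (2 / 3 * (l ^ 2 + 4 * l + 3) * exp (2 * l) * (\<Sum>i=1..n. p i ^ 4))"
    by (simp add: ennreal_leI)
qed

end
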